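(* Let $L$ be a planar triangulation with $n_L\ge 3$ vertices, embedded in the plane, and let $H$ be its planar conjugated triangulation. Every vertex of $H$ of degree $2$ is an external vertex of $H$.
   Context: A planar triangulation is a maximal planar simple graph; fix a plane embedding of $L$, so all faces of $L$ are triangles. The planar conjugated triangulation $H$ of $L$ is the plane graph whose vertices are the midpoints of the edges of $L$, and in which, for every bounded face of $L$, the three midpoints of its three boundary edges are joined pairwise by three segments drawn inside that face; nothing is drawn inside the unbounded face of $L$. A vertex of $H$ is external if it lies on the boundary of the unbounded face of $H$, and inner otherwise. *)

theory Defs
  imports "HOL-Analysis.Analysis"
begin

definition simple_graph :: "'a set \<Rightarrow> 'a set set \<Rightarrow> bool" where
  "simple_graph V E \<longleftrightarrow> finite V \<and> (\<forall>e\<in>E. e \<subseteq> V \<and> card e = 2)"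

text \<open>
  A plane graph has points of the plane as vertices and arcs \<open>\<gamma> e\<close>, indexed by a finite set \<open>E\<close>,
  as edges. An arc contains no vertices besides its two ends, and two arcs
  meet only in vertices, hence only in common ends.
\<close>

definition plane_graph :: "complex set \<Rightarrow> 'e set \<Rightarrow> ('e \<Rightarrow> real \<Rightarrow> complex) \<Rightarrow> bool" where
  "plane_graph V E \<gamma> \<longleftrightarrow>
     finite V \<and> finite E \<and>
     (\<forall>e\<in>E. arc (\<gamma> e) \<and> path_image (\<gamma> e) \<inter> V = {pathstart (\<gamma> e), pathfinish (\<gamma> e)}) \<and>
     (\<forall>e\<in>E. \<forall>e'\<in>E. e \<noteq> e' \<longrightarrow> path_image (\<gamma> e) \<inter> path_image (\<gamma> e') \<subseteq> V)"

definition drawing :: "complex set \<Rightarrow> 'e set \<Rightarrow> ('e \<Rightarrow> real \<Rightarrow> complex) \<Rightarrow> complex set" where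
  "drawing V E \<gamma> = V \<union> (\<Union>e\<in>E. path_image (\<gamma> e))"

definition faces :: "complex set \<Rightarrow> 'e set \<Rightarrow> ('e \<Rightarrow> real \<Rightarrow> complex) \<Rightarrow> complex set set" where
  "faces V E \<gamma> = components (- drawing V E \<gamma>)"

text \<open>Arcs are not closed, so there are no loops that would have to be counted twice.\<close>

definition vertex_degree :: "'e set \<Rightarrow> ('e \<Rightarrow> real \<Rightarrow> complex) \<Rightarrow> complex \<Rightarrow> nat" where
  "vertex_degree E \<gamma> x = card {e \<in> E. x = pathstart (\<gamma> e) \<or> x = pathfinish (\<gamma> e)}"

text \<open>The drawing of a plane graph is compact, so exactly one of its faces is unbounded.\<close>

definition external_vertex ::
    "complex set \<Rightarrow> 'e set \<Rightarrow> ('e \<Rightarrow> real \<Rightarrow> complex) \<Rightarrow> complex \<Rightarrow> bool" where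
  "external_vertex V E \<gamma> x \<longleftrightarrow>
     x \<in> V \<and> (\<exists>F\<in>faces V E \<gamma>. \<not> bounded F \<and> x \<in> frontier F)"

definition plane_embedding ::
    "'a set \<Rightarrow> 'a set set \<Rightarrow> ('a \<Rightarrow> complex) \<Rightarrow> ('a set \<Rightarrow> real \<Rightarrow> complex) \<Rightarrow> bool" where
  "plane_embedding V E p \<gamma> \<longleftrightarrow>
     inj_on p V \<and> plane_graph (p ` V) E \<gamma> \<and>
     (\<forall>e\<in>E. {pathstart (\<gamma> e), pathfinish (\<gamma> e)} = p ` e)"

definition planar_graph :: "'a set \<Rightarrow> 'a set set \<Rightarrow> bool" where
  "planar_graph V E \<longleftrightarrow> simple_graph V E \<and> (\<exists>p \<gamma>. plane_embedding V E p \<gamma>)"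

definition planar_triangulation :: "'a set \<Rightarrow> 'a set set \<Rightarrow> bool" where
  "planar_triangulation V E \<longleftrightarrow>
     planar_graph V E \<and>
     (\<forall>u\<in>V. \<forall>v\<in>V. u \<noteq> v \<and> {u, v} \<notin> E \<longrightarrow> \<not> planar_graph V (insert {u, v} E))"

definition boundary_edges :: "'e set \<Rightarrow> ('e \<Rightarrow> real \<Rightarrow> complex) \<Rightarrow> complex set \<Rightarrow> 'e set" where
  "boundary_edges E \<gamma> F = {e \<in> E. path_image (\<gamma> e) \<subseteq> frontier F}"

text \<open>
  Edges of an embedding are arbitrary arcs, and the midpoint is taken with respect to the
  parametrization. As the parametrization is arbitrary, this may be any inner point
  of the arc; for \<open>\<gamma> e = linepath a b\<close> it is the usual midpoint of the segment.
\<close>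

definition edge_midpoint :: "('e \<Rightarrow> real \<Rightarrow> complex) \<Rightarrow> 'e \<Rightarrow> complex" where
  "edge_midpoint \<gamma> e = \<gamma> e (1/2)"

definition conj_vertices :: "'a set set \<Rightarrow> ('a set \<Rightarrow> real \<Rightarrow> complex) \<Rightarrow> complex set" where
  "conj_vertices E \<gamma> = edge_midpoint \<gamma> ` E"

text \<open>
  There is one edge for each bounded face \<open>F\<close> and each pair of distinct boundary
  edges of \<open>F\<close>. Every bounded face of a triangulation with at least three vertices has exactly
  three boundary edges, so this gives three edges for each bounded face. The face is part of the index
  because the edge is to be drawn inside that face.
\<close>

definition conj_edges ::
    "'a set \<Rightarrow> 'a set set \<Rightarrow> ('a \<Rightarrow> complex) \<Rightarrow> ('a set \<Rightarrow> real \<Rightarrow> complex) \<Rightarrow>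
     (complex set \<times> 'a set set) set" where
  "conj_edges V E p \<gamma> =
     {(F, {e, e'}) | F e e'. F \<in> faces (p ` V) E \<gamma> \<and> bounded F \<and>
        e \<in> boundary_edges E \<gamma> F \<and> e' \<in> boundary_edges E \<gamma> F \<and> e \<noteq> e'}"

text \<open>
  \<open>\<delta>\<close> is a drawing of the planar conjugated triangulation of the embedded graph
  \<open>(V, E, p, \<gamma>)\<close>: it is a plane graph, and the edge for \<open>F\<close> and \<open>{e, e'}\<close> joins the midpoints
  of \<open>e\<close> and \<open>e'\<close> and otherwise runs inside \<open>F\<close>.
\<close>

definition planar_conjugated_triangulation ::
    "'a set \<Rightarrow> 'a set set \<Rightarrow> ('a \<Rightarrow> complex) \<Rightarrow> ('a set \<Rightarrow> real \<Rightarrow> complex) \<Rightarrow>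
     (complex set \<times> 'a set set \<Rightarrow> real \<Rightarrow> complex) \<Rightarrow> bool" where
  "planar_conjugated_triangulation V E p \<gamma> \<delta> \<longleftrightarrow>
     plane_graph (conj_vertices E \<gamma>) (conj_edges V E p \<gamma>) \<delta> \<and>
     (\<forall>F e e'. (F, {e, e'}) \<in> conj_edges V E p \<gamma> \<longrightarrow>
        {pathstart (\<delta> (F, {e, e'})), pathfinish (\<delta> (F, {e, e'}))} =
          {edge_midpoint \<gamma> e, edge_midpoint \<gamma> e'} \<and>
        path_image (\<delta> (F, {e, e'})) - {edge_midpoint \<gamma> e, edge_midpoint \<gamma> e'} \<subseteq> F)"

end

theory Submission
  imports Defs
begin

text \<open>
  The only tool from plane topology besides the Jordan curve theorem is Janiszewski's theorem. Completing a piece of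
  an arc to a Jordan curve, it shows that a point close to an arc can be moved along the arc without leaving its
  side of the arc and a given neighbourhood. Hence a face whose closure meets the interior of an edge has the
  whole edge on its boundary, and every vertex on the boundary of a face is accessible from it. By
  maximality the vertices on the boundary of a face are thus pairwise adjacent. A face has a boundary vertex outside
  any given edge, since an arc does not separate the plane, so every boundary edge lies on a triangle; the two
  sides of that triangle give two faces at the edge. Two edges of a simple graph do not separate the plane
  either, so each of these faces has at least three boundary edges. If both were bounded, the midpoint would have
  degree at least \<open>4\<close>; so one of them is the unbounded face, which lies in the unbounded face of \<open>H\<close>.
\<close>

section \<open>Sides of an arc\<close>

text \<open>Invariance of dimension: the inverse of the parametrization would map a nonempty open
  set injectively and continuously into the reals.\<close>

lemma interior_arc_empty:
  fixes g :: "real \<Rightarrow> 'a::euclidean_space"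
  assumes "arc g" "2 \<le> DIM('a)"
  shows "interior (path_image g) = {}"
proof (rule ccontr)
  assume ne: "interior (path_image g) \<noteq> {}"
  obtain h where h: "homeomorphism {0..1} (path_image g) g h"
    using homeomorphism_arc assms(1) by blast
  have "continuous_on (interior (path_image g)) h"
    using h homeomorphism_cont2 continuous_on_subset interior_subset by metis
  moreover have "inj_on h (interior (path_image g))"
    using h interior_subset[of "path_image g"]
    by (intro inj_on_inverseI[where g = g]) (auto simp: homeomorphism_def subset_iff)
  ultimately have "DIM('a) \<le> DIM(real)"
    using invariance_of_dimension ne open_interior by blast
  then show False using assms(2) by simp
qed

text \<open>The part of \<open>g\<close> between \<open>c\<close> and \<open>d\<close>, together
  with \<open>h\<close>, forms a Jordan curve containing the given middle part. Such an
  \<open>h\<close> exists because the complement of an arc is a connected open set whose frontier is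
  the whole arc, and pairs of accessible frontier points are dense.\<close>

lemma arc_completion:
  fixes g :: "real \<Rightarrow> complex"
  assumes "arc g" "0 < a" "a \<le> b" "b < 1"
  obtains c d h where "0 < c" "c < a" "b < d" "d < 1" "arc h"
    "pathstart h = g d" "pathfinish h = g c" "path_image h \<inter> path_image g = {g c, g d}"
proof -
  let ?S = "- path_image g"
  have S: "open ?S" "connected ?S"
    using assms by (auto simp: closed_arc_image connected_arc_complement)
  have fr: "frontier ?S = path_image g"
    using assms(1) by (simp only: frontier_complement) (simp add: frontier_def interior_arc_empty closed_arc_image)
  obtain k where k: "homeomorphism {0..1} (path_image g) g k"
    using homeomorphism_arc assms(1) by blast
  have inj: "inj_on g {0..1}" using assms(1) by (simp add: arc_def)
  have "openin (top_of_set {0..1}) ({0..1} \<inter> {0<..<a})" "openin (top_of_set {0..1}) ({0..1} \<inter> {b<..<1})"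
    by (auto intro: openin_open_Int)
  moreover have "{0..1} \<inter> {0<..<a} = {0<..<a}" "{0..1} \<inter> {b<..<1} = {b<..<1}"
    using assms by auto
  ultimately have op: "openin (top_of_set (frontier ?S)) (g ` {0<..<a})" "openin (top_of_set (frontier ?S)) (g ` {b<..<1})"
    using homeomorphism_imp_open_map[OF k] fr by auto
  have "a/2 \<in> {0<..<a}" using assms by auto
  \<comment> \<open>The density theorem for pairs of accessible points is applied to two different
    relatively open pieces of the frontier; \<open>g (a/2)\<close> tells them apart.\<close>
  moreover have "g (a/2) \<notin> g ` {b<..<1}"
  proof
    assume "g (a/2) \<in> g ` {b<..<1}"
    then obtain x where "x \<in> {b<..<1}" "g (a/2) = g x" by auto
    moreover from this have "a/2 = x" using assms by (intro inj_onD[OF inj]) auto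
    ultimately show False using assms by auto
  qed
  ultimately have "g ` {0<..<a} \<noteq> g ` {b<..<1}" by blast
  moreover have "g ` {0<..<a} \<noteq> {}" "g ` {b<..<1} \<noteq> {}" using assms by auto
  ultimately obtain h where h: "arc h" "pathstart h \<in> g ` {b<..<1}" "pathfinish h \<in> g ` {0<..<a}" "h ` {0<..<1} \<subseteq> ?S"
    using dense_accessible_frontier_point_pairs[OF S op(2) op(1)] by metis
  then obtain c d where cd: "0 < c" "c < a" "b < d" "d < 1" "pathstart h = g d" "pathfinish h = g c" by auto
  have "path_image h = insert (pathstart h) (insert (pathfinish h) (h ` {0<..<1}))"
  proof -
    have "{0..1::real} = insert 0 (insert 1 {0<..<1})" by auto
    then show ?thesis unfolding path_image_def pathstart_def pathfinish_def by (metis image_insert)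
  qed
  moreover have "g c \<in> path_image g" "g d \<in> path_image g" using cd assms by (auto simp: path_image_def)
  ultimately have "path_image h \<inter> path_image g = {g c, g d}" using h cd by auto
  then show ?thesis using that cd h(1) by blast
qed

text \<open>With the arc closed up to a Jordan curve \<open>J\<close>, the point \<open>p\<close>
  and suitable points \<open>q\<close> near \<open>g t\<close> lie on the same side of
  \<open>J\<close>. A closed set \<open>T\<close> that misses the arc piece does not separate them
  either, since the piece itself links them. Janiszewski's theorem combines both facts because
  \<open>J \<inter> T\<close> is connected.\<close>

lemma arc_slide:
  fixes g :: "real \<Rightarrow> complex"
  assumes "arc g" "0 < a" "b < 1" "s \<in> {a..b}" "t \<in> {a..b}" "open N" "g ` {a..b} \<subseteq> N"
  shows "\<exists>r>0. \<forall>p\<in>ball (g s) r - path_image g. \<forall>r'>0.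
    \<exists>q\<in>ball (g t) r'. connected_component (N - path_image g) p q"
proof -
  have ab: "a \<le> b" using assms by auto
  obtain c d h where cd: "0 < c" "c < a" "b < d" "d < 1" and h: "arc h"
    "pathstart h = g d" "pathfinish h = g c" "path_image h \<inter> path_image g = {g c, g d}"
    using arc_completion[OF assms(1,2) ab assms(3)] by metis
  have inj: "inj_on g {0..1}" and con: "continuous_on {0..1} g" using assms(1) by (auto simp: arc_def path_def)
  have img: "g ` X \<subseteq> path_image g" if "X \<subseteq> {0..1}" for X
    using that by (auto simp: path_image_def)
  have pre: "openin (top_of_set {0..1}) ({0..1} \<inter> g -` N)"
    using con assms(6) by (rule continuous_openin_preimage_gen)
  obtain e where e: "e > 0" "\<And>x. x \<in> {0..1} \<Longrightarrow> dist x a < e \<Longrightarrow> g x \<in> N"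
  proof -
    have "a \<in> {0..1} \<inter> g -` N" using assms ab by auto
    then obtain e where "e > 0" "ball a e \<inter> {0..1} \<subseteq> {0..1} \<inter> g -` N"
      using pre by (meson openin_contains_ball)
    then show ?thesis using that by (force simp: dist_commute)
  qed
  obtain e' where e': "e' > 0" "\<And>x. x \<in> {0..1} \<Longrightarrow> dist x b < e' \<Longrightarrow> g x \<in> N"
  proof -
    have "b \<in> {0..1} \<inter> g -` N" using assms ab by auto
    then obtain e where "e > 0" "ball b e \<inter> {0..1} \<subseteq> {0..1} \<inter> g -` N"
      using pre by (meson openin_contains_ball)
    then show ?thesis using that by (force simp: dist_commute)
  qed
  \<comment> \<open>The interval from \<open>a'\<close> to \<open>b'\<close> is slightly larger than
    \<open>{a..b}\<close>: the midpoints keep it between \<open>c\<close> and \<open>d\<close>,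
    while \<open>e/2\<close> and \<open>e'/2\<close> keep its image in \<open>N\<close>.\<close>
  define a' where "a' = max ((c + a)/2) (a - e/2)"
  define b' where "b' = min ((d + b)/2) (b + e'/2)"
  have a': "c < a'" "a' < a" "a - a' < e" using cd e by (auto simp: a'_def max_def field_simps)
  have b': "b < b'" "b' < d" "b' - b < e'" using cd e' by (auto simp: b'_def min_def field_simps)
  have gN: "g ` {a'..b'} \<subseteq> N"
  proof clarify
    fix x assume x: "x \<in> {a'..b'}"
    have x01: "x \<in> {0..1}" using x a' b' cd by auto
    consider "x < a" | "x \<in> {a..b}" | "x > b" by force
    then show "g x \<in> N"
    proof cases
      case 1 then show ?thesis using e(2)[OF x01] x a' by (auto simp: dist_real_def)
    next
      case 2 then show ?thesis using assms by auto
    next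
      case 3 then show ?thesis using e'(2)[OF x01] x b' by (auto simp: dist_real_def)
    qed
  qed
  \<comment> \<open>Without the two end pieces of the arc, \<open>M\<close> meets the arc only in
    \<open>J\<close>. Hence a set that avoids both \<open>J\<close> and \<open>- M\<close> stays in
    \<open>N\<close> and off the arc.\<close>
  define M where "M = N - g ` {0..c} - g ` {d..1}"
  have cl: "compact (g ` {x..y})" "connected (g ` {x..y})" if "0 \<le> x" "y \<le> 1" for x y
  proof -
    have "continuous_on {x..y} g" using con that continuous_on_subset by (metis atLeastatMost_subset_iff)
    then show "compact (g ` {x..y})" "connected (g ` {x..y})"
      by (auto intro: compact_continuous_image connected_continuous_image)
  qed
  have opM: "open M" unfolding M_def
    using assms(6) cl cd ab by (auto intro!: open_Diff compact_imp_closed)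
  have disj: "g ` X \<inter> g ` Y = {}" if "X \<subseteq> {0..1}" "Y \<subseteq> {0..1}" "X \<inter> Y = {}" for X Y
    using inj that by (metis image_empty inj_on_image_Int)
  have gM: "g ` {a'..b'} \<subseteq> M"
  proof -
    have "g ` {a'..b'} \<inter> g ` {0..c} = {}" by (rule disj) (use a' b' cd ab in auto)
    moreover have "g ` {a'..b'} \<inter> g ` {d..1} = {}" by (rule disj) (use a' b' cd ab in auto)
    ultimately show ?thesis using gN by (auto simp: M_def)
  qed
  \<comment> \<open>\<open>K\<close> is connected since \<open>h\<close> links the two remaining
    pieces of \<open>g\<close>.\<close>
  define K where "K = path_image h \<union> g ` {c..a'} \<union> g ` {b'..d}"
  have hends: "g c \<in> path_image h" "g d \<in> path_image h" using h by auto
  have "compact K" unfolding K_def using cl a' b' cd ab h(1) by (auto intro!: compact_Un simp: compact_arc_image)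
  have "connected K" unfolding K_def
  proof (intro connected_Un)
    show "connected (path_image h)" using h(1) by (simp add: connected_arc_image)
    show "connected (g ` {c..a'})" "connected (g ` {b'..d})" using cl a' b' cd ab by auto
    show "path_image h \<inter> g ` {c..a'} \<noteq> {}" using hends a' by force
    show "(path_image h \<union> g ` {c..a'}) \<inter> g ` {b'..d} \<noteq> {}" using hends b' by force
  qed
  define C where "C = subpath c d g +++ h"
  define J where "J = path_image C"
  have sub: "arc (subpath c d g)" using arc_subpath_arc assms(1) cd ab by force
  have subim: "path_image (subpath c d g) = g ` {c..d}" using cd ab by (simp add: path_image_subpath)
  have "path_image (subpath c d g) \<inter> path_image h \<subseteq> {g c, g d}"
    using h(4) img[of "{c..d}"] cd ab subim by auto
  then have simp: "simple_path C" "pathfinish C = pathstart C"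
    unfolding C_def using simple_path_join_loop[OF sub h(1)] h by auto
  have J: "J = g ` {c..d} \<union> path_image h"
    unfolding J_def C_def using h subim by (simp add: path_image_join)
  have comJ: "compact J" unfolding J_def using simp by (simp add: compact_simple_path_image)
  have jordan: "open (inside J)" "connected (inside J)" "open (outside J)" "connected (outside J)"
    "inside J \<union> outside J = - J" "frontier (inside J) = J" "frontier (outside J) = J"
    using Jordan_inside_outside[OF simp] by (simp_all add: J_def)
  \<comment> \<open>Janiszewski's theorem is applied to \<open>J\<close> and \<open>T\<close>: their intersection is \<open>J\<close> without a small open arc.\<close>
  define T where "T = K \<union> - M"
  have cloT: "closed T" unfolding T_def using \<open>compact K\<close> opM by (auto intro: compact_imp_closed)
  have JT: "J \<inter> T = K"
  proof
    have "g ` {c..a'} \<subseteq> g ` {c..d}" "g ` {b'..d} \<subseteq> g ` {c..d}" using a' b' cd ab by auto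
    then show "K \<subseteq> J \<inter> T" by (auto simp: K_def T_def J)
    show "J \<inter> T \<subseteq> K"
    proof
      fix z assume z: "z \<in> J \<inter> T"
      show "z \<in> K"
      proof (rule ccontr)
        assume nz: "z \<notin> K"
        then obtain x where x: "x \<in> {c..d}" "z = g x" "z \<notin> M" using z by (auto simp: J K_def T_def)
        then have "x \<notin> {c..a'}" "x \<notin> {b'..d}" using nz by (auto simp: K_def)
        then have "x \<in> {a'..b'}" using x by auto
        then have "g x \<in> M" using gM by blast
        then show False using x by auto
      qed
    qed
  qed
  have gT: "g ` {a..b} \<subseteq> - T"
  proof -
    have "g ` {a..b} \<inter> g ` {c..a'} = {}" by (rule disj) (use a' b' cd ab in auto)
    moreover have "g ` {a..b} \<inter> g ` {b'..d} = {}" by (rule disj) (use a' b' cd ab in auto)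
    moreover have "g ` {a..b} \<inter> path_image h = {}"
    proof -
      have "g ` {a..b} \<inter> g ` {c,d} = {}" by (rule disj) (use a' b' cd ab in auto)
      moreover have "g ` {a..b} \<subseteq> path_image g" by (rule img) (use assms in auto)
      moreover have "path_image h \<inter> path_image g \<subseteq> g ` {c,d}" using h(4) by simp
      ultimately show ?thesis by blast
    qed
    moreover have "g ` {a..b} \<subseteq> M" using gM a' b' by fastforce
    ultimately show ?thesis by (auto simp: T_def K_def)
  qed
  have opT: "open (- T)" using cloT by auto
  \<comment> \<open>\<open>r\<close> depends on \<open>T\<close> and \<open>s\<close> only, so it
    serves all \<open>p\<close> and all \<open>r'\<close>.\<close>
  obtain r where r: "r > 0" "ball (g s) r \<subseteq> - T"
    using opT gT assms(4) by (metis image_subset_iff open_contains_ball)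
  obtain r2 where r2: "r2 > 0" "ball (g t) r2 \<subseteq> - T"
    using opT gT assms(5) by (metis image_subset_iff open_contains_ball)
  have Mg: "M \<inter> path_image g \<subseteq> J"
  proof
    fix z assume z: "z \<in> M \<inter> path_image g"
    then obtain x where x: "x \<in> {0..1}" "z = g x" by (auto simp: path_image_def)
    then have "x \<notin> {0..c}" "x \<notin> {d..1}" using z by (auto simp: M_def)
    then have "x \<in> {c..d}" using x by auto
    then show "z \<in> J" using x by (auto simp: J)
  qed
  have sub: "- (J \<union> T) \<subseteq> N - path_image g"
  proof -
    have "- (J \<union> T) \<subseteq> M - J" by (auto simp: T_def)
    then show ?thesis using Mg by (auto simp: M_def)
  qed
  show ?thesis
  proof (intro exI[of _ r] conjI ballI allI impI r(1))
    fix p r' assume p: "p \<in> ball (g s) r - path_image g" and r': "(r'::real) > 0"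
    have pT: "p \<notin> T" using p r by auto
    \<comment> \<open>\<open>J\<close> consists of points of the arc and of \<open>h\<close>, and
      \<open>h\<close> lies in \<open>T\<close>.\<close>
    then have pJ: "p \<notin> J" using p img[of "{c..d}"] cd ab by (auto simp: J K_def T_def)
    \<comment> \<open>Either side of a Jordan curve has the whole curve as its frontier, so the side
      that contains \<open>p\<close> has points as close to \<open>g t\<close> as desired.\<close>
    obtain I where I: "open I" "connected I" "frontier I = J" "I \<subseteq> - J" "p \<in> I"
    proof (cases "p \<in> inside J")
      case True then show ?thesis
        using that[of "inside J"] jordan(1,2,6) Un_upper1[of "inside J" "outside J"] unfolding jordan(5) by simp
    next
      case False
      then have "p \<in> outside J" using pJ jordan(5) by (metis ComplI UnE)
      then show ?thesis
        using that[of "outside J"] jordan(3,4,7) Un_upper2[of "outside J" "inside J"] unfolding jordan(5) by simp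
    qed
    have "g t \<in> frontier I" using assms(5) cd I J by auto
    then have "g t \<in> closure I" by (simp add: frontier_def)
    then obtain q where q: "q \<in> I" "dist q (g t) < min r' r2"
      using r' r2(1) closure_approachable by (metis min_less_iff_conj)
    have qb: "q \<in> ball (g t) r'" "q \<in> ball (g t) r2" using q(2) by (auto simp: dist_commute)
    have "connected_component (- J) p q"
      using I q unfolding connected_component_def by blast
    moreover have "connected_component (- T) p q"
      unfolding connected_component_def
    proof (intro exI conjI)
      \<comment> \<open>This set may cross the arc; at this point only \<open>T\<close> has to be
        avoided.\<close>
      show "connected (ball (g s) r \<union> g ` {a..b} \<union> ball (g t) r2)"
      proof (intro connected_Un)
        show "connected (g ` {a..b})" using cl assms by auto
        have "g s \<in> ball (g s) r \<inter> g ` {a..b}" "g t \<in> (ball (g s) r \<union> g ` {a..b}) \<inter> ball (g t) r2"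
          using r r2 assms by auto
        then show "ball (g s) r \<inter> g ` {a..b} \<noteq> {}" "(ball (g s) r \<union> g ` {a..b}) \<inter> ball (g t) r2 \<noteq> {}"
          by blast+
      qed auto
      show "ball (g s) r \<union> g ` {a..b} \<union> ball (g t) r2 \<subseteq> - T" using r r2 gT by auto
      show "p \<in> ball (g s) r \<union> g ` {a..b} \<union> ball (g t) r2" using p by auto
      show "q \<in> ball (g s) r \<union> g ` {a..b} \<union> ball (g t) r2" using qb by auto
    qed
    ultimately have "connected_component (- (J \<union> T)) p q"
      using Janiszewski[OF comJ cloT] JT \<open>connected K\<close> by auto
    then have "connected_component (N - path_image g) p q"
      using sub connected_component_of_subset by blast
    then show "\<exists>q\<in>ball (g t) r'. connected_component (N - path_image g) p q" using qb by blast
  qed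
qed

section \<open>Accessibility of the ends of an arc\<close>

text \<open>Infinitely many paths are traversed one after the other on the half-line, the
  \<open>n\<close>-th in unit time on \<open>{real n..real n + 1}\<close>. Since the sets
  \<open>B n\<close> shrink to \<open>a\<close>, the result can be compactified by the value
  \<open>a\<close> at infinity.\<close>

lemma infinite_path_join:
  fixes p :: "nat \<Rightarrow> 'a::real_normed_vector"
  assumes pc: "\<And>n. path_component (B n) (p n) (p (Suc n))" and BU: "\<And>n. B n \<subseteq> U"
    and lim: "\<And>e. e > 0 \<Longrightarrow> \<exists>k. \<forall>n\<ge>k. B n \<subseteq> ball a e"
  obtains g where "path g" "pathstart g = a" "g ` {0<..1} \<subseteq> U"
proof -
  obtain c where c: "\<And>n. path (c n)" "\<And>n. path_image (c n) \<subseteq> B n"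
    "\<And>n. pathstart (c n) = p n" "\<And>n. pathfinish (c n) = p (Suc n)"
    using pc unfolding path_component_def by metis
  define f where "f t = c (nat \<lfloor>t\<rfloor>) (t - of_int \<lfloor>t\<rfloor>)" for t :: real
  have f_eq: "f t = c n (t - real n)" if t: "t \<in> {real n..real n + 1}" for t n
  proof (cases "t = real n + 1")
    \<comment> \<open>At the right end of its interval the floor has already jumped to
      \<open>n + 1\<close>; the value agrees because consecutive paths share an end.\<close>
    case True
    then have "\<lfloor>t\<rfloor> = int n + 1" by simp
    then show ?thesis using True c(3)[of "Suc n"] c(4)[of n]
      by (simp add: f_def nat_add_distrib pathstart_def pathfinish_def)
  next
    case False
    then have "\<lfloor>t\<rfloor> = int n" using t by (simp add: floor_eq_iff)
    then show ?thesis by (simp add: f_def)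
  qed
  have f_in: "f t \<in> B (nat \<lfloor>t\<rfloor>)" if "t \<ge> 0" for t
  proof -
    have "t - of_int \<lfloor>t\<rfloor> \<in> {0..1}" by (simp, linarith)
    then show ?thesis using c(2)[of "nat \<lfloor>t\<rfloor>"] unfolding f_def path_image_def by blast
  qed
  have cont1: "continuous_on {real n..real n + 1} f" for n
  proof -
    have "continuous_on {real n..real n + 1} (\<lambda>t. c n (t - real n))"
      by (rule continuous_on_compose2[of "{0..1}" "c n"]) (use c(1) in \<open>auto simp: path_def intro!: continuous_intros\<close>)
    then show ?thesis by (rule continuous_on_eq) (simp add: f_eq)
  qed
  have contn: "continuous_on {0..real n} f" for n
  proof (induction n)
    case (Suc n)
    have "{0..real (Suc n)} = {0..real n} \<union> {real n..real n + 1}" by auto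
    then show ?case using continuous_on_closed_Un[OF _ _ Suc cont1] by simp
  qed simp
  have contf: "continuous_on {0..} f"
    unfolding continuous_on_eq_continuous_within
  proof
    fix t :: real assume t: "t \<in> {0..}"
    obtain n where n: "t < real n" using reals_Archimedean2 by blast
    have "at t within {0..} = at t within {0..real n}"
      by (rule at_within_nhd[of _ "{..<real n}"]) (use n in auto)
    moreover have "continuous (at t within {0..real n}) f"
      using contn[of n] t n by (auto simp: continuous_on_eq_continuous_within)
    ultimately show "continuous (at t within {0..}) f" by simp
  qed
  \<comment> \<open>The substitution \<open>1/x - 1\<close> maps \<open>{0<..1}\<close> onto the
    half-line and reverses time, so that the limit point becomes the start of the path.\<close>
  define h where "h x = (if x \<le> 0 then a else f (1/x - 1))" for x :: real
  have "continuous_on {0<..1} (\<lambda>x::real. f (1/x - 1))"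
    by (rule continuous_on_compose2[OF contf]) (auto intro!: continuous_intros)
  then have conth: "continuous_on {0<..1} h"
    by (rule continuous_on_eq) (simp add: h_def)
  have "path h" unfolding path_def continuous_on_eq_continuous_within
  proof
    fix x :: real assume x: "x \<in> {0..1}"
    show "continuous (at x within {0..1}) h"
    proof (cases "x = 0")
      case False
      have "at x within {0..1} = at x within {0<..1}"
        by (rule at_within_nhd[of _ "{0<..}"]) (use x False in auto)
      then show ?thesis
        using conth x False by (auto simp: continuous_on_eq_continuous_within)
    next
      case True
      have "\<exists>d>0. \<forall>y\<in>{0..1}. 0 < dist y 0 \<and> dist y 0 < d \<longrightarrow> dist (h y) a < e" if e: "e > 0" for e
      proof -
        obtain k where k: "\<And>n. n \<ge> k \<Longrightarrow> B n \<subseteq> ball a e" using lim[OF e] by blast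
        have "dist (h y) a < e" if y: "y \<in> {0..1}" "y \<noteq> 0" "y < 1 / (real k + 1)" for y
        proof -
          have "1/y - 1 > real k" using y by (simp add: field_simps)
          then have "nat \<lfloor>1/y - 1\<rfloor> \<ge> k" "1/y - 1 \<ge> 0" by linarith+
          then have "h y \<in> ball a e" using k f_in y unfolding h_def by fastforce
          then show ?thesis by (simp add: dist_commute)
        qed
        then show ?thesis by (intro exI[of _ "1 / (real k + 1)"]) auto
      qed
      then have "(h \<longlongrightarrow> a) (at 0 within {0..1})" unfolding Lim_within by blast
      moreover have "h 0 = a" by (simp add: h_def)
      ultimately show ?thesis using True by (simp add: continuous_within)
    qed
  qed
  moreover have "pathstart h = a" by (simp add: pathstart_def h_def)
  moreover have "h ` {0<..1} \<subseteq> U"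
  proof clarify
    fix x :: real assume x: "x \<in> {0<..1}"
    then have "1/x - 1 \<ge> 0" by simp
    then have "f (1/x - 1) \<in> U" using f_in BU by (meson subsetD)
    then show "h x \<in> U" using x by (simp add: h_def)
  qed
  ultimately show ?thesis using that by blast
qed

text \<open>A path is enough here, since concatenation produces paths; an arc is extracted only in
  \<open>accessible_points_arc\<close>.\<close>

definition accessible_from :: "'a::topological_space set \<Rightarrow> 'a \<Rightarrow> bool" where
  "accessible_from F a \<longleftrightarrow> (\<exists>h. path h \<and> pathstart h = a \<and> h ` {0<..1} \<subseteq> F)"

lemma component_absorbs:
  assumes "F \<in> components S" "p \<in> F" "connected_component T p q" "T \<subseteq> S"
  shows "q \<in> F"
  using assms by (metis components_iff connected_component_eq connected_component_of_subset mem_Collect_eq)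

text \<open>Points of \<open>F\<close> close to \<open>g s\<close> slide to points close to
  \<open>g t\<close> inside \<open>N - path_image g\<close>, hence within the component
  \<open>F\<close>. In the application \<open>N\<close> is the complement of all the rest of a
  drawing.\<close>

lemma arc_in_closure_component:
  fixes g :: "real \<Rightarrow> complex"
  assumes g: "arc g" "open N" "g ` {0<..<1} \<subseteq> N" and F: "F \<in> components (N - path_image g)"
    and s: "g s \<in> closure F" "s \<in> {0<..<1}" and t: "t \<in> {0<..<1}"
  shows "g t \<in> closure F"
proof -
  have "g ` {min s t..max s t} \<subseteq> N" using g(3) s t by force
  moreover have "0 < min s t" "max s t < 1" "s \<in> {min s t..max s t}" "t \<in> {min s t..max s t}"
    using s t by auto
  ultimately obtain r where r: "r > 0" "\<forall>p\<in>ball (g s) r - path_image g. \<forall>r'>0.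
      \<exists>q\<in>ball (g t) r'. connected_component (N - path_image g) p q"
    using arc_slide[OF g(1) _ _ _ _ g(2), of "min s t" "max s t" s t] by blast
  obtain p where p: "p \<in> F" "p \<in> ball (g s) r"
    using s(1) r(1) by (auto simp: closure_approachable dist_commute)
  have pg: "p \<notin> path_image g" using in_components_subset[OF F] p by blast
  show ?thesis unfolding closure_approachable
  proof (intro allI impI)
    fix e :: real assume "e > 0"
    then obtain q where q: "q \<in> ball (g t) e" "connected_component (N - path_image g) p q"
      using r(2) p pg by blast
    then have "q \<in> F" using component_absorbs[OF F p(1)] by blast
    then show "\<exists>y\<in>F. dist y (g t) < e" using q(1) by (auto simp: dist_commute)
  qed
qed

text \<open>Sliding from \<open>g (t n)\<close> to \<open>g (t (Suc n))\<close> with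
  \<open>t n\<close> tending to \<open>0\<close> produces a sequence in \<open>F\<close>. Its
  consecutive points are joined within shrinking neighbourhoods of the arc, so that a path in
  \<open>F\<close> ends up at \<open>g 0\<close>.\<close>

lemma arc_start_accessible:
  fixes g :: "real \<Rightarrow> complex"
  assumes g: "arc g" "open N" "g ` {0<..<1} \<subseteq> N" and F: "F \<in> components (N - path_image g)"
    and s: "g s \<in> closure F" "s \<in> {0<..<1}"
  shows "accessible_from F (g 0)"
proof -
  define t where "t n = s / (real n + 1)" for n
  \<comment> \<open>Neighbourhoods of consecutive arc pieces; the radius
    \<open>1 / (real n + 1)\<close> makes them shrink to \<open>g 0\<close> together with the
    pieces.\<close>
  define M where "M n = N \<inter> (\<Union>x\<in>{t (Suc n)..t n}. ball (g x) (1 / (real n + 1)))" for n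
  have t: "0 < t n" "t n < 1" "t n \<le> s" "t (Suc n) \<le> t n" for n
  proof -
    show "0 < t n" using s by (simp add: t_def)
    show "t n \<le> s" using s by (simp add: t_def field_simps)
    then show "t n < 1" using s by simp
    show "t (Suc n) \<le> t n" using s unfolding t_def by (intro divide_left_mono) auto
  qed
  have opM: "open (M n)" for n unfolding M_def using g(2) by auto
  have gM: "g ` {t (Suc n)..t n} \<subseteq> M n" for n
  proof clarify
    fix x assume x: "x \<in> {t (Suc n)..t n}"
    then have "x \<in> {0<..<1}" using t[of n] t[of "Suc n"] by auto
    then show "g x \<in> M n" using g(3) x by (auto simp: M_def intro!: bexI[of _ x])
  qed
  have "\<exists>r>0. \<forall>p\<in>ball (g (t n)) r - path_image g. \<forall>r'>0.
      \<exists>q\<in>ball (g (t (Suc n))) r'. connected_component (M n - path_image g) p q" for n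
  proof (rule arc_slide[OF g(1) t(1)[of "Suc n"] t(2)[of n] _ _ opM gM])
    show "t n \<in> {t (Suc n)..t n}" "t (Suc n) \<in> {t (Suc n)..t n}" using t(4) by auto
  qed
  then obtain r where r: "\<And>n. r n > 0" "\<And>n. \<forall>p\<in>ball (g (t n)) (r n) - path_image g. \<forall>r'>0.
      \<exists>q\<in>ball (g (t (Suc n))) r'. connected_component (M n - path_image g) p q"
    by metis
  have Fg: "F \<subseteq> N - path_image g" using in_components_subset[OF F] .
  have MN: "M n - path_image g \<subseteq> N - path_image g" for n by (auto simp: M_def)
  \<comment> \<open>All radii \<open>r n\<close> are known beforehand, so each slide can be made to
    end within the radius from which the next one starts.\<close>
  have "\<exists>p. \<forall>n. p n \<in> F \<inter> ball (g (t n)) (r n) \<and> connected_component (M n - path_image g) (p n) (p (Suc n))"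
  proof (rule dependent_nat_choice)
    have "g (t 0) \<in> closure F" using arc_in_closure_component[OF g F s] t[of 0] by auto
    then show "\<exists>x. x \<in> F \<inter> ball (g (t 0)) (r 0)"
      using r(1)[of 0] by (auto simp: closure_approachable dist_commute)
  next
    fix x n assume x: "x \<in> F \<inter> ball (g (t n)) (r n)"
    then obtain y where y: "y \<in> ball (g (t (Suc n))) (r (Suc n))" "connected_component (M n - path_image g) x y"
      using r(2)[of n] r(1)[of "Suc n"] Fg by blast
    then have "y \<in> F" using component_absorbs[OF F _ y(2) MN] x by auto
    then show "\<exists>y. y \<in> F \<inter> ball (g (t (Suc n))) (r (Suc n)) \<and> connected_component (M n - path_image g) x y"
      using y by blast
  qed
  then obtain p where p: "\<And>n. p n \<in> F" "\<And>n. connected_component (M n - path_image g) (p n) (p (Suc n))"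
    by blast
  \<comment> \<open>Components of an open set are open and hence path connected, which turns
    connectedness into the paths needed for the concatenation.\<close>
  define B where "B n = connected_component_set (M n - path_image g) (p n)" for n
  have opB: "open (B n)" for n unfolding B_def
    by (intro open_connected_component open_Diff opM closed_arc_image g)
  have "path_component (B n) (p n) (p (Suc n))" for n
  proof -
    have "path_connected (B n)" using opB connected_open_path_connected by (auto simp: B_def)
    moreover have "p n \<in> B n" "p (Suc n) \<in> B n"
      using p(2)[of n] by (auto simp: B_def connected_component_in intro: connected_component_refl dest: connected_component_in)
    ultimately show ?thesis by (simp add: path_connected_component)
  qed
  moreover have "B n \<subseteq> F" for n
    using component_absorbs[OF F p(1) _ MN] by (auto simp: B_def)
  \<comment> \<open>One half of \<open>e\<close> bounds the distance from \<open>g 0\<close> to the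
    arc piece, by continuity at \<open>0\<close>, the other half the radius of the
    neighbourhood.\<close>
  moreover have "\<exists>k. \<forall>n\<ge>k. B n \<subseteq> ball (g 0) e" if e: "e > 0" for e
  proof -
    have "continuous_on {0..1} g" using g(1) by (simp add: arc_def path_def)
    then obtain d where d: "d > 0" "\<And>x. x \<in> {0..1} \<Longrightarrow> dist x 0 < d \<Longrightarrow> dist (g x) (g 0) < e/2"
      using e half_gt_zero[OF e] unfolding continuous_on_iff by (metis atLeastAtMost_iff order_refl zero_le_one)
    obtain k where k: "1 / real (Suc k) < min d (e/2)" using nat_approx_posE[of "min d (e/2)"] d e by auto
    have "B n \<subseteq> ball (g 0) e" if n: "n \<ge> k" for n
    proof
      fix z assume "z \<in> B n"
      then have "z \<in> M n" using connected_component_subset unfolding B_def by blast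
      then obtain x where x: "x \<in> {t (Suc n)..t n}" "dist (g x) z < 1 / (real n + 1)" by (auto simp: M_def)
      have kn: "1 / (real n + 1) \<le> 1 / real (Suc k)" using n by (simp add: frac_le)
      have "t n \<le> 1 / (real n + 1)" using s unfolding t_def by (intro divide_right_mono) auto
      then have "dist x 0 < d" "x \<in> {0..1}" using x t[of n] t[of "Suc n"] k kn by auto
      then have "dist (g x) (g 0) < e/2" using d by blast
      then show "z \<in> ball (g 0) e" using x(2) kn k dist_triangle[of "g 0" z "g x"] by (simp add: dist_commute)
    qed
    then show ?thesis by blast
  qed
  ultimately obtain h where "path h" "pathstart h = g 0" "h ` {0<..1} \<subseteq> F"
    using infinite_path_join by metis
  then show ?thesis unfolding accessible_from_def by blast
qed

lemma arc_ends_accessible: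
  fixes g :: "real \<Rightarrow> complex"
  assumes g: "arc g" "open N" "g ` {0<..<1} \<subseteq> N" and F: "F \<in> components (N - path_image g)"
    and s: "g s \<in> closure F" "s \<in> {0<..<1}"
  shows "accessible_from F (pathstart g)" "accessible_from F (pathfinish g)"
proof -
  show "accessible_from F (pathstart g)"
    using arc_start_accessible[OF assms] by (simp add: pathstart_def)
  have "accessible_from F (reversepath g 0)"
  proof (rule arc_start_accessible[where s = "1 - s"])
    show "reversepath g ` {0<..<1} \<subseteq> N" using g(3) by (force simp: reversepath_def)
    show "reversepath g (1 - s) \<in> closure F" using s by (simp add: reversepath_def)
  qed (use assms in \<open>auto simp: arc_reversepath\<close>)
  then show "accessible_from F (pathfinish g)" by (simp add: reversepath_def pathfinish_def)
qed

text \<open>The two access paths are joined inside \<open>F\<close>, and a path between distinct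
  points contains an arc between them.\<close>

lemma accessible_points_arc:
  fixes F :: "'a::{complete_space,real_normed_vector} set"
  assumes "accessible_from F a" "accessible_from F b" "a \<noteq> b" "open F" "connected F"
  obtains g where "arc g" "pathstart g = a" "pathfinish g = b" "path_image g \<subseteq> F \<union> {a, b}"
proof -
  obtain h k where h: "path h" "pathstart h = a" "h ` {0<..1} \<subseteq> F"
    and k: "path k" "pathstart k = b" "k ` {0<..1} \<subseteq> F"
    using assms unfolding accessible_from_def by blast
  have im: "path_image f = insert (pathstart f) (f ` {0<..1})" for f :: "real \<Rightarrow> 'a"
  proof -
    have "{0..1::real} = insert 0 {0<..1}" by auto
    then show ?thesis unfolding path_image_def pathstart_def by (metis image_insert)
  qed
  have "pathfinish h \<in> F" "pathfinish k \<in> F" using h k by (auto simp: pathfinish_def)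
  then obtain m where m: "path m" "path_image m \<subseteq> F" "pathstart m = pathfinish h" "pathfinish m = pathfinish k"
    using connected_open_path_connected[OF assms(4,5)] unfolding path_connected_def by blast
  define c where "c = h +++ (m +++ reversepath k)"
  have "path c" "pathstart c = a" "pathfinish c = b" using h k m by (auto simp: c_def)
  moreover have "path_image c \<subseteq> F \<union> {a, b}"
    using h k m im[of h] im[of k] by (auto simp: c_def path_image_join)
  ultimately show ?thesis using path_contains_arc[of c a b] assms(3) that by (metis subset_trans)
qed

section \<open>Faces of plane graphs\<close>

context
  fixes V :: "complex set" and E :: "'e set" and \<gamma> :: "'e \<Rightarrow> real \<Rightarrow> complex"
  assumes pg: "plane_graph V E \<gamma>"
begin

lemma plane_graph_arc: "e \<in> E \<Longrightarrow> arc (\<gamma> e)"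
  using pg by (auto simp: plane_graph_def)

lemma path_image_subset_drawing: "e \<in> E \<Longrightarrow> path_image (\<gamma> e) \<subseteq> drawing V E \<gamma>"
  by (auto simp: drawing_def)

lemma closed_partial_drawing:
  assumes "V' \<subseteq> V" "E' \<subseteq> E"
  shows "closed (drawing V' E' \<gamma>)"
proof -
  have "finite V'" "finite E'" using pg assms finite_subset by (auto simp: plane_graph_def)
  then show ?thesis unfolding drawing_def
    using plane_graph_arc assms(2) by (intro closed_Un closed_UN finite_imp_closed) (auto simp: closed_arc_image)
qed

lemma closed_drawing: "closed (drawing V E \<gamma>)"
  using closed_partial_drawing by blast

text \<open>An inner point in the rest of the drawing would be a vertex, hence an end of the edge,
  against injectivity. So the complement of the rest is an open neighbourhood of the open edge and
  can serve as \<open>N\<close> in the arc lemmas.\<close>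

lemma inner_point_not_in_rest:
  assumes "e \<in> E" "s \<in> {0<..<1}"
  shows "\<gamma> e s \<notin> drawing V (E - {e}) \<gamma>"
proof
  assume *: "\<gamma> e s \<in> drawing V (E - {e}) \<gamma>"
  have im: "\<gamma> e s \<in> path_image (\<gamma> e)" using assms by (auto simp: path_image_def)
  have "\<gamma> e s \<in> V"
    using * im assms(1) pg unfolding drawing_def plane_graph_def by blast
  then have "\<gamma> e s = \<gamma> e 0 \<or> \<gamma> e s = \<gamma> e 1"
    using im assms(1) pg unfolding plane_graph_def pathstart_def pathfinish_def by blast
  moreover have "inj_on (\<gamma> e) {0..1}" using plane_graph_arc[OF assms(1)] by (simp add: arc_def)
  ultimately show False using assms(2) by (auto dest: inj_onD)
qed

lemma complement_drawing:
  assumes "e \<in> E"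
  shows "- drawing V E \<gamma> = - drawing V (E - {e}) \<gamma> - path_image (\<gamma> e)"
  using assms by (auto simp: drawing_def)

lemma face_properties:
  assumes "F \<in> faces V E \<gamma>"
  shows "open F" "connected F" "F \<noteq> {}" "F \<inter> drawing V E \<gamma> = {}" "frontier F \<subseteq> drawing V E \<gamma>"
    "frontier F = closure F - F"
proof -
  have F: "F \<in> components (- drawing V E \<gamma>)" using assms by (simp add: faces_def)
  show "open F" using open_components[OF _ F] closed_drawing by blast
  then show "frontier F = closure F - F" by (simp add: frontier_def interior_open)
  show "connected F" "F \<noteq> {}" using F in_components_connected in_components_nonempty by blast+
  show "F \<inter> drawing V E \<gamma> = {}" using in_components_subset[OF F] by blast
  show "frontier F \<subseteq> drawing V E \<gamma>" using frontier_of_components_closed_complement closed_drawing F by blast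
qed

lemma faces_eq:
  assumes "F \<in> faces V E \<gamma>" "F' \<in> faces V E \<gamma>" "F \<inter> F' \<noteq> {}"
  shows "F = F'"
  using assms components_eq unfolding faces_def by blast

text \<open>Faces are the components of the complement of the remaining drawing minus the edge, so
  the arc lemmas apply. The closure of \<open>F\<close> contains the open edge and therefore also
  its ends.\<close>

lemma edge_in_frontier:
  assumes "e \<in> E" "F \<in> faces V E \<gamma>" "\<gamma> e s \<in> closure F" "s \<in> {0<..<1}"
  shows "e \<in> boundary_edges E \<gamma> F"
    and "accessible_from F (pathstart (\<gamma> e))" and "accessible_from F (pathfinish (\<gamma> e))"
proof -
  have F: "F \<in> components (- drawing V (E - {e}) \<gamma> - path_image (\<gamma> e))"
    using assms(2) complement_drawing[OF assms(1)] by (simp add: faces_def)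
  have N: "open (- drawing V (E - {e}) \<gamma>)" using closed_partial_drawing[of V "E - {e}"] by auto
  have gN: "\<gamma> e ` {0<..<1} \<subseteq> - drawing V (E - {e}) \<gamma>" using inner_point_not_in_rest assms(1) by blast
  note arc = plane_graph_arc[OF assms(1)]
  show "accessible_from F (pathstart (\<gamma> e))" "accessible_from F (pathfinish (\<gamma> e))"
    using arc_ends_accessible[OF arc N gN F assms(3,4)] by blast+
  have "\<gamma> e ` {0<..<1} \<subseteq> closure F"
    using arc_in_closure_component[OF arc N gN F assms(3,4)] by blast
  moreover have "closure {0<..<1::real} = {0..1}" by simp
  moreover have "continuous_on {0..1} (\<gamma> e)" using arc by (simp add: arc_def path_def)
  ultimately have "path_image (\<gamma> e) \<subseteq> closure F"
    using image_closure_subset[of "{0<..<1::real}" "\<gamma> e" "closure F"] by (simp add: path_image_def)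
  then show "e \<in> boundary_edges E \<gamma> F"
    using face_properties[OF assms(2)] path_image_subset_drawing[OF assms(1)] assms(1)
    by (auto simp: boundary_edges_def)
qed

lemma drawing_cases:
  assumes "z \<in> drawing V E \<gamma>"
  obtains "z \<in> V" | e s where "e \<in> E" "s \<in> {0<..<1}" "z = \<gamma> e s"
proof (cases "z \<in> V")
  case False
  then obtain e s where e: "e \<in> E" "s \<in> {0..1}" "z = \<gamma> e s"
    using assms by (auto simp: drawing_def path_image_def)
  have "\<gamma> e 0 \<in> V" "\<gamma> e 1 \<in> V"
    using pg e(1) unfolding plane_graph_def pathstart_def pathfinish_def by blast+
  then have "s \<noteq> 0" "s \<noteq> 1" using False e by auto
  then show ?thesis using that(2)[of e s] e by auto
qed (use that in blast)

text \<open>A frontier point that is no vertex is an inner point of an edge, which is then a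
  boundary edge. \<open>V\<close> appears separately because an isolated vertex can lie on the
  frontier.\<close>

lemma frontier_face_subset:
  assumes "F \<in> faces V E \<gamma>"
  shows "frontier F \<subseteq> V \<union> (\<Union>e\<in>boundary_edges E \<gamma> F. path_image (\<gamma> e))"
proof
  fix z assume z: "z \<in> frontier F"
  then have "z \<in> drawing V E \<gamma>" using face_properties[OF assms] by blast
  then show "z \<in> V \<union> (\<Union>e\<in>boundary_edges E \<gamma> F. path_image (\<gamma> e))"
  proof (cases rule: drawing_cases)
    case (2 e s)
    have "e \<in> boundary_edges E \<gamma> F"
      using edge_in_frontier(1)[OF 2(1) assms _ 2(2)] z 2(3) by (simp add: frontier_def)
    moreover have "z \<in> path_image (\<gamma> e)" using 2 by (auto simp: path_image_def)
    ultimately show ?thesis by blast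
  qed blast
qed

text \<open>A small disc around \<open>a\<close> meets only edges that end in \<open>a\<close>.
  Either the punctured disc lies in \<open>F\<close>, or it meets the frontier of \<open>F\<close>
  in an inner point of such an edge, whose ends are accessible.\<close>

lemma frontier_vertex_accessible:
  assumes F: "F \<in> faces V E \<gamma>" and a: "a \<in> V" "a \<in> frontier F"
  shows "accessible_from F a"
proof -
  define R where "R = drawing (V - {a}) {e\<in>E. a \<notin> path_image (\<gamma> e)} \<gamma>"
  have "closed R" unfolding R_def by (rule closed_partial_drawing) auto
  moreover have "a \<notin> R" by (auto simp: R_def drawing_def)
  ultimately obtain r where r: "r > 0" "ball a r \<subseteq> - R"
    by (metis ComplI open_Compl open_contains_ball)
  have aF: "a \<notin> F" "a \<in> closure F" using face_properties(6)[OF F] a by auto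
  show ?thesis
  proof (cases "ball a r - {a} \<subseteq> F")
    case True
    \<comment> \<open>\<open>F\<close> surrounds \<open>a\<close>, so a straight segment gives
      access.\<close>
    define h where "h = linepath a (a + of_real (r/2))"
    have "h t \<in> F" if t: "t \<in> {0<..1}" for t
    proof -
      have "h t = a + of_real (t * r/2)" by (simp add: h_def linepath_def algebra_simps scaleR_conv_of_real)
      moreover have "t * r \<le> 1 * r" using t r(1) by (intro mult_right_mono) auto
      then have "norm (of_real (t * r/2) :: complex) < r" "t * r / 2 \<noteq> 0"
        unfolding norm_of_real using t r(1) by auto
      ultimately have "h t \<in> ball a r - {a}" by (simp add: dist_norm)
      then show ?thesis using True by blast
    qed
    then show ?thesis unfolding accessible_from_def
      by (intro exI[of _ h]) (auto simp: h_def)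
  next
    case False
    have "connected (ball a r - {a})" by (intro connected_open_delete) auto
    moreover have "(ball a r - {a}) \<inter> F \<noteq> {}"
      using aF r(1) by (force simp: closure_approachable dist_commute)
    moreover have "(ball a r - {a}) - F \<noteq> {}" using False by blast
    ultimately have "(ball a r - {a}) \<inter> frontier F \<noteq> {}" by (rule connected_Int_frontier)
    then obtain z where z: "z \<in> ball a r" "z \<noteq> a" "z \<in> frontier F" by blast
    then have "z \<in> drawing V E \<gamma>" using face_properties[OF F] by blast
    then show ?thesis
    proof (cases rule: drawing_cases)
      case 1
      then show ?thesis using z r by (auto simp: R_def drawing_def)
    next
      case (2 e s)
      then have "z \<in> path_image (\<gamma> e)" by (auto simp: path_image_def)
      then have "a \<in> path_image (\<gamma> e)" using z r 2(1) by (auto simp: R_def drawing_def)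
      then have "a = pathstart (\<gamma> e) \<or> a = pathfinish (\<gamma> e)"
        using pg a(1) 2(1) unfolding plane_graph_def by blast
      moreover have "\<gamma> e s \<in> closure F" using z 2(3) by (simp add: frontier_def)
      ultimately show ?thesis using edge_in_frontier(2,3)[OF 2(1) F _ 2(2)] by blast
    qed
  qed
qed

text \<open>The connected set \<open>- X\<close> contains \<open>F\<close> and misses its frontier,
  so it equals \<open>F\<close>; but \<open>F\<close> misses the drawing.\<close>

lemma drawing_subset_nonseparating:
  assumes F: "F \<in> faces V E \<gamma>" and X: "X \<subseteq> drawing V E \<gamma>" "connected (- X)" "frontier F \<subseteq> X"
  shows "drawing V E \<gamma> \<subseteq> X"
proof -
  have "- X \<subseteq> F"
  proof (rule ccontr)
    assume "\<not> - X \<subseteq> F"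
    then have "- X \<inter> frontier F \<noteq> {}"
      using face_properties(3,4)[OF F] X(1) by (intro connected_Int_frontier[OF X(2)]) blast+
    then show False using X(3) by blast
  qed
  then show ?thesis using face_properties(4)[OF F] by blast
qed

text \<open>This finds a face on a prescribed side \<open>I\<close> of an edge. A point
  \<open>q\<close> of \<open>I\<close> close to the edge lies in some face, and the slide from
  \<open>s\<close> to \<open>s\<close> itself shows that this face has points arbitrarily close to
  \<open>\<gamma> e s\<close>.\<close>

lemma face_near_inner_point:
  assumes e: "e \<in> E" "s \<in> {0<..<1}" and I: "\<gamma> e s \<in> closure I" "I \<inter> path_image (\<gamma> e) = {}"
  obtains F where "F \<in> faces V E \<gamma>" "F \<inter> I \<noteq> {}" "e \<in> boundary_edges E \<gamma> F"
proof -
  let ?N = "- drawing V (E - {e}) \<gamma>"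
  have N: "open ?N" using closed_partial_drawing[of V "E - {e}"] by auto
  have gN: "\<gamma> e ` {s..s} \<subseteq> ?N" using inner_point_not_in_rest[OF e] by auto
  obtain r where r: "r > 0" "\<forall>q\<in>ball (\<gamma> e s) r - path_image (\<gamma> e). \<forall>r'>0.
      \<exists>q'\<in>ball (\<gamma> e s) r'. connected_component (?N - path_image (\<gamma> e)) q q'"
    using arc_slide[OF plane_graph_arc[OF e(1)] _ _ _ _ N gN, of s s] e(2) by auto
  obtain r0 where r0: "r0 > 0" "ball (\<gamma> e s) r0 \<subseteq> ?N" using N gN by (metis imageI atLeastAtMost_iff open_contains_ball order_refl subsetD)
  obtain q where q: "q \<in> I" "dist q (\<gamma> e s) < min r r0"
    using I(1) r(1) r0(1) unfolding closure_approachable by (metis min_less_iff_conj)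
  have qg: "q \<notin> path_image (\<gamma> e)" using q I by blast
  have qN: "q \<in> ?N" using q r0 by (auto simp: dist_commute)
  define F where "F = connected_component_set (- drawing V E \<gamma>) q"
  have qD: "q \<in> - drawing V E \<gamma>" using qg qN complement_drawing[OF e(1)] by simp
  then have F: "F \<in> faces V E \<gamma>" unfolding faces_def F_def by (rule componentsI)
  have "q \<in> F" using qD by (simp add: F_def connected_component_refl)
  moreover have "\<gamma> e s \<in> closure F" unfolding closure_approachable
  proof (intro allI impI)
    fix d :: real assume "d > 0"
    then obtain q' where "q' \<in> ball (\<gamma> e s) d" "connected_component (?N - path_image (\<gamma> e)) q q'"
      using r(2) q qg by (force simp: dist_commute)
    then show "\<exists>y\<in>F. dist y (\<gamma> e s) < d"
      using complement_drawing[OF e(1)] by (auto simp: F_def dist_commute)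
  qed
  ultimately show ?thesis using that[OF F] q(1) edge_in_frontier(1)[OF e(1) F _ e(2)] by blast
qed

end

section \<open>Faces of triangulations\<close>

text \<open>Otherwise an arc through \<open>F\<close> could be added to the embedding as the edge
  \<open>{u, v}\<close>, against maximality.\<close>

lemma joinable_imp_adjacent:
  assumes tri: "planar_triangulation V E" and emb: "plane_embedding V E p \<gamma>"
    and F: "F \<in> faces (p ` V) E \<gamma>"
    and uv: "u \<in> V" "v \<in> V" "u \<noteq> v" "accessible_from F (p u)" "accessible_from F (p v)"
  shows "{u, v} \<in> E"
proof (rule ccontr)
  assume nE: "{u, v} \<notin> E"
  let ?e = "{u, v}"
  have pg: "plane_graph (p ` V) E \<gamma>" and inj: "inj_on p V"
    and ends: "\<forall>e\<in>E. {pathstart (\<gamma> e), pathfinish (\<gamma> e)} = p ` e"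
    using emb by (auto simp: plane_embedding_def)
  have sg: "simple_graph V E" using tri by (simp add: planar_triangulation_def planar_graph_def)
  have "p u \<noteq> p v" using inj uv by (auto dest: inj_onD)
  then obtain g where g: "arc g" "pathstart g = p u" "pathfinish g = p v" "path_image g \<subseteq> F \<union> {p u, p v}"
    using accessible_points_arc uv(4,5) face_properties(1,2)[OF pg F] by metis
  have FD: "F \<inter> drawing (p ` V) E \<gamma> = {}" using face_properties[OF pg F] by blast
  have gi: "path_image g \<inter> drawing (p ` V) E \<gamma> \<subseteq> {p u, p v}" using g(4) FD by blast
  have ge: "p u \<in> path_image g" "p v \<in> path_image g" using g(2,3) pathstart_in_path_image pathfinish_in_path_image by metis+
  have VD: "p ` V \<subseteq> drawing (p ` V) E \<gamma>" by (simp add: drawing_def)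
  define \<gamma>' where "\<gamma>' = \<gamma>(?e := g)"
  have \<gamma>': "\<gamma>' ?e = g" "\<And>e. e \<in> E \<Longrightarrow> \<gamma>' e = \<gamma> e" using nE by (auto simp: \<gamma>'_def)
  have puv: "{p u, p v} \<subseteq> p ` V" using uv by auto
  have ggV: "path_image g \<inter> p ` V = {p u, p v}"
    using gi ge VD puv by blast
  have gE: "path_image g \<inter> path_image (\<gamma> e) \<subseteq> p ` V" if "e \<in> E" for e
  proof -
    have "path_image (\<gamma> e) \<subseteq> drawing (p ` V) E \<gamma>" using that by (auto simp: drawing_def)
    then show ?thesis using gi puv by blast
  qed
  have "plane_graph (p ` V) (insert ?e E) \<gamma>'"
    unfolding plane_graph_def
  proof (intro conjI ballI impI)
    show "finite (p ` V)" "finite (insert ?e E)" using pg by (auto simp: plane_graph_def)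
  next
    fix e assume "e \<in> insert ?e E"
    then consider "e = ?e" | "e \<in> E" by blast
    then have "arc (\<gamma>' e) \<and> path_image (\<gamma>' e) \<inter> p ` V = {pathstart (\<gamma>' e), pathfinish (\<gamma>' e)}"
      by cases (use g ggV pg in \<open>simp_all add: \<gamma>' plane_graph_def\<close>)
    then show "arc (\<gamma>' e)" "path_image (\<gamma>' e) \<inter> p ` V = {pathstart (\<gamma>' e), pathfinish (\<gamma>' e)}"
      by auto
  next
    fix e e' assume ee: "e \<in> insert ?e E" "e' \<in> insert ?e E" "e \<noteq> e'"
    then consider "e = ?e" "e' \<in> E" | "e \<in> E" "e' = ?e" | "e \<in> E" "e' \<in> E" by blast
    then show "path_image (\<gamma>' e) \<inter> path_image (\<gamma>' e') \<subseteq> p ` V"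
    proof cases
      case 1 then show ?thesis using gE by (simp add: \<gamma>')
    next
      case 2 then show ?thesis using gE by (simp add: \<gamma>' Int_commute)
    next
      case 3 then show ?thesis using pg ee(3) by (simp add: \<gamma>' plane_graph_def)
    qed
  qed
  moreover have "\<forall>e\<in>insert ?e E. {pathstart (\<gamma>' e), pathfinish (\<gamma>' e)} = p ` e"
    using ends g by (simp add: \<gamma>')
  ultimately have "plane_embedding V (insert ?e E) p \<gamma>'"
    using inj by (simp add: plane_embedding_def)
  moreover have "simple_graph V (insert ?e E)" using sg uv by (simp add: simple_graph_def)
  ultimately have "planar_graph V (insert ?e E)" by (auto simp: planar_graph_def)
  then show False using tri uv nE by (auto simp: planar_triangulation_def)
qed

context
  fixes V :: "'a set" and E :: "'a set set" and p :: "'a \<Rightarrow> complex" and \<gamma> :: "'a set \<Rightarrow> real \<Rightarrow> complex"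
  assumes tri: "planar_triangulation V E" and three: "card V \<ge> 3" and emb: "plane_embedding V E p \<gamma>"
begin

private lemma pg: "plane_graph (p ` V) E \<gamma>"
  and inj: "inj_on p V"
  and ends: "e \<in> E \<Longrightarrow> {pathstart (\<gamma> e), pathfinish (\<gamma> e)} = p ` e"
  and edge_subset: "e \<in> E \<Longrightarrow> e \<subseteq> V"
  and card_edge: "e \<in> E \<Longrightarrow> card e = 2"
  using tri emb by (auto simp: plane_embedding_def planar_triangulation_def planar_graph_def simple_graph_def)

private lemma edge_vertices: "e \<in> E \<Longrightarrow> path_image (\<gamma> e) \<inter> p ` V = p ` e"
  using pg ends by (simp add: plane_graph_def)

private lemma edges_Int:
  assumes "e \<in> E" "e' \<in> E" "e \<noteq> e'"
  shows "path_image (\<gamma> e) \<inter> path_image (\<gamma> e') \<subseteq> p ` (e \<inter> e')"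
proof -
  have "path_image (\<gamma> e) \<inter> path_image (\<gamma> e') \<subseteq> p ` V" using pg assms by (auto simp: plane_graph_def)
  then have "path_image (\<gamma> e) \<inter> path_image (\<gamma> e') \<subseteq> p ` e \<inter> p ` e'"
    using edge_vertices assms by blast
  then show ?thesis using inj_on_image_Int[OF inj] edge_subset assms by metis
qed

text \<open>If all vertices on the frontier were \<open>u\<close> or \<open>v\<close>, simplicity
  would leave \<open>{u, v}\<close> as the only possible boundary edge, and the frontier would lie
  on one arc. An arc does not separate the plane, so the whole drawing would lie on it, leaving only
  two vertices.\<close>

private lemma frontier_third_vertex:
  assumes F: "F \<in> faces (p ` V) E \<gamma>" and e: "{u, v} \<in> E"
  obtains w where "w \<in> V" "w \<noteq> u" "w \<noteq> v" "p w \<in> frontier F"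
proof (rule ccontr)
  assume "\<not> thesis"
  then have no: "\<And>w. w \<in> V \<Longrightarrow> p w \<in> frontier F \<Longrightarrow> w \<in> {u, v}" using that by blast
  let ?X = "path_image (\<gamma> {u, v})"
  have "frontier F \<subseteq> ?X"
  proof
    fix z assume z: "z \<in> frontier F"
    then consider "z \<in> p ` V" | e where "e \<in> boundary_edges E \<gamma> F" "z \<in> path_image (\<gamma> e)"
      using frontier_face_subset[OF pg F] by blast
    then show "z \<in> ?X"
    proof cases
      case 1
      then have "z \<in> p ` {u, v}" using no z by blast
      then show ?thesis using edge_vertices[OF e] by blast
    next
      case (2 d)
      then have d: "d \<in> E" "path_image (\<gamma> d) \<subseteq> frontier F" by (auto simp: boundary_edges_def)
      have "d \<subseteq> {u, v}"
      proof
        fix x assume x: "x \<in> d"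
        then have "p x \<in> path_image (\<gamma> d)" using edge_vertices[OF d(1)] by blast
        then show "x \<in> {u, v}" using no d x edge_subset by blast
      qed
      then have "d = {u, v}" using card_edge[OF d(1)] card_edge[OF e] by (metis card_subset_eq card.infinite zero_neq_numeral)
      then show ?thesis using 2 by simp
    qed
  qed
  moreover have "connected (- ?X)"
    using connected_arc_complement[OF plane_graph_arc[OF pg e]] by simp
  ultimately have "drawing (p ` V) E \<gamma> \<subseteq> ?X"
    using drawing_subset_nonseparating[OF pg F] path_image_subset_drawing[OF pg e] by blast
  then have "p ` V \<subseteq> p ` {u, v}" using edge_vertices[OF e] by (auto simp: drawing_def)
  then have "V \<subseteq> {u, v}" using inj edge_subset[OF e] by (metis inj_on_image_subset_iff order_refl)
  then have "card V \<le> card {u, v}" by (intro card_mono) auto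
  then show False using three card_edge[OF e] by simp
qed

text \<open>All three vertices are accessible from the same face, so they are pairwise
  adjacent.\<close>

private lemma triangle_at_boundary_edge:
  assumes F: "F \<in> faces (p ` V) E \<gamma>" and e: "{u, v} \<in> boundary_edges E \<gamma> F"
  obtains w where "w \<in> V" "w \<noteq> u" "w \<noteq> v" "{u, w} \<in> E" "{v, w} \<in> E"
proof -
  have eE: "{u, v} \<in> E" "path_image (\<gamma> {u, v}) \<subseteq> frontier F" using e by (auto simp: boundary_edges_def)
  obtain w where w: "w \<in> V" "w \<noteq> u" "w \<noteq> v" "p w \<in> frontier F"
    using frontier_third_vertex[OF F eE(1)] by blast
  have uv: "u \<in> V" "v \<in> V" using edge_subset[OF eE(1)] by auto
  have "p u \<in> frontier F" "p v \<in> frontier F" using edge_vertices[OF eE(1)] eE(2) by blast+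
  then have acc: "accessible_from F (p u)" "accessible_from F (p v)" "accessible_from F (p w)"
    using frontier_vertex_accessible[OF pg F] w uv by blast+
  show ?thesis
    using that[OF w(1-3)] joinable_imp_adjacent[OF tri emb F] uv w acc by metis
qed

text \<open>Two edges of a simple graph share at most one vertex, so their arcs meet in a connected
  set and together do not separate the plane. If they covered all boundary edges, the drawing would
  consist of them and the vertices, but a triangle at \<open>e\<close> has a further edge.\<close>

private lemma card_boundary_edges:
  assumes F: "F \<in> faces (p ` V) E \<gamma>" and e: "e \<in> boundary_edges E \<gamma> F"
  shows "card (boundary_edges E \<gamma> F) \<ge> 3"
proof (rule ccontr)
  assume "\<not> ?thesis"
  then have le: "card (boundary_edges E \<gamma> F) \<le> 2" by simp
  have eE: "e \<in> E" using e by (auto simp: boundary_edges_def)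
  obtain u v where uv: "e = {u, v}" "u \<noteq> v" using card_edge[OF eE] by (metis card_2_iff)
  obtain w where w: "w \<in> V" "w \<noteq> u" "w \<noteq> v" "{u, w} \<in> E" "{v, w} \<in> E"
    using triangle_at_boundary_edge[OF F] e uv(1) by blast
  have fin: "finite (boundary_edges E \<gamma> F)" using pg by (auto simp: plane_graph_def boundary_edges_def)
  \<comment> \<open>If \<open>e\<close> is the only boundary edge, another side of the triangle is
    taken as \<open>d\<close>, so that both cases give a pair of edges.\<close>
  obtain d where d: "d \<in> E" "d \<noteq> e" "boundary_edges E \<gamma> F \<subseteq> {e, d}"
  proof (cases "boundary_edges E \<gamma> F = {e}")
    case True
    have "{u, w} \<noteq> e" using uv w by auto
    then show ?thesis using that[of "{u, w}"] w True by auto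
  next
    case False
    then obtain d where d: "d \<in> boundary_edges E \<gamma> F" "d \<noteq> e" using e by blast
    then have "{e, d} = boundary_edges E \<gamma> F"
      using e le fin by (intro card_seteq) auto
    then show ?thesis using that[of d] d by (auto simp: boundary_edges_def)
  qed
  let ?Y = "path_image (\<gamma> e) \<union> path_image (\<gamma> d)"
  have arcs: "arc (\<gamma> e)" "arc (\<gamma> d)" using plane_graph_arc[OF pg] eE d(1) by blast+
  have fine: "finite e" "finite d" using card_edge eE d(1) by (auto intro: card_ge_0_finite)
  have "card (e \<inter> d) \<noteq> 2"
  proof
    assume "card (e \<inter> d) = 2"
    then have "e \<inter> d = e" "e \<inter> d = d"
      using fine card_edge[OF eE] card_edge[OF d(1)] by (simp_all add: card_subset_eq)
    then show False using d(2) by blast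
  qed
  moreover have "card (e \<inter> d) \<le> 2" using card_mono[OF fine(1), of "e \<inter> d"] card_edge[OF eE] by simp
  ultimately have c1: "card (e \<inter> d) \<le> 1" by linarith
  have "connected (path_image (\<gamma> e) \<inter> path_image (\<gamma> d))"
  proof -
    have "card (e \<inter> d) = 0 \<or> card (e \<inter> d) = 1" using c1 by linarith
    then have "e \<inter> d = {} \<or> (\<exists>z. e \<inter> d = {z})" using fine by (auto simp: card_1_singleton_iff)
    then obtain a where "p ` (e \<inter> d) \<subseteq> {a}" by (metis empty_subsetI image_empty image_insert order_refl)
    then have "path_image (\<gamma> e) \<inter> path_image (\<gamma> d) \<subseteq> {a}"
      using edges_Int[OF eE d(1)] d(2) by (metis order_trans)
    then show ?thesis by (metis connected_empty connected_sing subset_singletonD)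
  qed
  then have "connected (- ?Y)"
    using arcs by (intro Janiszewski_connected) (auto simp: compact_arc_image closed_arc_image connected_arc_complement)
  moreover have "open (- ?Y)" using arcs by (intro open_Compl closed_Un closed_arc_image)
  \<comment> \<open>Vertices off the two arcs are finitely many points, whose removal keeps an open
    connected plane set connected.\<close>
  ultimately have "connected (- ?Y - p ` V)"
    using pg by (intro connected_open_delete_finite) (auto simp: plane_graph_def)
  moreover have "- ?Y - p ` V = - (?Y \<union> p ` V)" by blast
  moreover have "frontier F \<subseteq> ?Y \<union> p ` V" using frontier_face_subset[OF pg F] d(3) by blast
  moreover have "?Y \<union> p ` V \<subseteq> drawing (p ` V) E \<gamma>" using eE d(1) by (auto simp: drawing_def)
  ultimately have D: "drawing (p ` V) E \<gamma> \<subseteq> ?Y \<union> p ` V"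
    using drawing_subset_nonseparating[OF pg F, of "?Y \<union> p ` V"] by argo
  have "{u, w} \<noteq> e" "{v, w} \<noteq> e" "{u, w} \<noteq> {v, w}" using uv w by (auto simp: doubleton_eq_iff)
  \<comment> \<open>The triangle has two sides other than \<open>e\<close>, and at most one of them
    is \<open>d\<close>.\<close>
  then obtain c where c: "c \<in> E" "c \<noteq> e" "c \<noteq> d" using w by metis
  have half: "1/2 \<in> {0<..<1::real}" by simp
  have "\<gamma> c (1/2) \<in> path_image (\<gamma> c)" by (simp add: path_image_def)
  then have "\<gamma> c (1/2) \<in> drawing (p ` V) E \<gamma>" using path_image_subset_drawing[OF pg c(1)] by blast
  moreover have "?Y \<union> p ` V \<subseteq> drawing (p ` V) (E - {c}) \<gamma>" using eE d(1) c by (auto simp: drawing_def)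
  ultimately show False using D inner_point_not_in_rest[OF pg c(1) half] by blast
qed

private lemma oriented_edge:
  assumes "{a, b} \<in> E" "a \<noteq> b"
  obtains g where "arc g" "pathstart g = p a" "pathfinish g = p b" "path_image g = path_image (\<gamma> {a, b})"
proof -
  let ?g = "\<gamma> {a, b}"
  have arc: "arc ?g" using plane_graph_arc[OF pg assms(1)] .
  have "{pathstart ?g, pathfinish ?g} = {p a, p b}" using ends[OF assms(1)] by simp
  then consider "pathstart ?g = p a" "pathfinish ?g = p b" | "pathstart ?g = p b" "pathfinish ?g = p a"
    by (auto simp: doubleton_eq_iff)
  then show ?thesis
  proof cases
    case 1 then show ?thesis using that arc by blast
  next
    case 2 then show ?thesis using that[of "reversepath ?g"] arc by (simp add: arc_reversepath)
  qed
qed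

text \<open>Some face at \<open>e\<close> yields a triangle through \<open>e\<close>, whose sides
  form a Jordan curve \<open>J\<close>. Inside and outside of \<open>J\<close> both accumulate at
  the midpoint of \<open>e\<close>, and each provides a face there.\<close>

private lemma two_faces_at_edge:
  assumes e: "e \<in> E"
  obtains F F' where "F \<in> faces (p ` V) E \<gamma>" "F' \<in> faces (p ` V) E \<gamma>" "F \<noteq> F'"
    "e \<in> boundary_edges E \<gamma> F" "e \<in> boundary_edges E \<gamma> F'"
proof -
  have half: "1/2 \<in> {0<..<1::real}" by simp
  have im: "\<gamma> e (1/2) \<in> path_image (\<gamma> e)" by (auto simp: path_image_def)
  \<comment> \<open>The first face is found with no side prescribed: an arc has empty interior, so
    its complement accumulates at the midpoint.\<close>
  have "interior (path_image (\<gamma> e)) = {}" using interior_arc_empty[OF plane_graph_arc[OF pg e]] by simp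
  then have "\<gamma> e (1/2) \<in> closure (- path_image (\<gamma> e))" by (simp add: closure_complement)
  then obtain F0 where F0: "F0 \<in> faces (p ` V) E \<gamma>" "e \<in> boundary_edges E \<gamma> F0"
    using face_near_inner_point[OF pg e half, of "- path_image (\<gamma> e)"] by blast
  obtain u v where uv: "e = {u, v}" "u \<noteq> v" using card_edge[OF e] by (metis card_2_iff)
  obtain w where w: "w \<in> V" "w \<noteq> u" "w \<noteq> v" "{u, w} \<in> E" "{v, w} \<in> E"
    using triangle_at_boundary_edge[OF F0(1)] F0(2) uv(1) by blast
  have wu: "{w, u} \<in> E" using w(4) by (simp add: insert_commute)
  obtain g1 where g1: "arc g1" "pathstart g1 = p u" "pathfinish g1 = p v" "path_image g1 = path_image (\<gamma> {u, v})"
    using oriented_edge[of u v] e uv by blast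
  obtain g2 where g2: "arc g2" "pathstart g2 = p v" "pathfinish g2 = p w" "path_image g2 = path_image (\<gamma> {v, w})"
    using oriented_edge[OF w(5)] w(3) by blast
  obtain g3 where g3: "arc g3" "pathstart g3 = p w" "pathfinish g3 = p u" "path_image g3 = path_image (\<gamma> {w, u})"
    using oriented_edge[OF wu] w(2) by blast
  have "{u, v} \<noteq> {v, w}" "{v, w} \<noteq> {w, u}" "{u, v} \<noteq> {w, u}" using uv w by (auto simp: doubleton_eq_iff)
  moreover have "{u, v} \<inter> {v, w} = {v}" "{v, w} \<inter> {w, u} = {w}" "{u, v} \<inter> {w, u} = {u}"
    using uv w by auto
  ultimately have I: "path_image g1 \<inter> path_image g2 \<subseteq> {p v}" "path_image g2 \<inter> path_image g3 \<subseteq> {p w}"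
    "path_image g1 \<inter> path_image g3 \<subseteq> {p u}"
    using edges_Int[OF _ w(5), of "{u, v}"] edges_Int[OF w(5) wu] edges_Int[OF _ wu, of "{u, v}"]
      e uv(1) g1(4) g2(4) g3(4) by (metis image_empty image_insert)+
  have g23: "arc (g2 +++ g3)" using arc_join[of g2 g3] g2 g3 I by simp
  define C where "C = g1 +++ (g2 +++ g3)"
  have "path_image (g2 +++ g3) = path_image g2 \<union> path_image g3"
    using g2 g3 by (simp add: path_image_join)
  then have "path_image g1 \<inter> path_image (g2 +++ g3) \<subseteq> {p u, p v}"
    using I by blast
  then have simp: "simple_path C" "pathfinish C = pathstart C"
    unfolding C_def using simple_path_join_loop[OF g1(1) g23] g1 g2 g3 by auto
  define J where "J = path_image C"
  have J: "J = path_image (\<gamma> e) \<union> path_image (\<gamma> {v, w}) \<union> path_image (\<gamma> {w, u})"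
    unfolding J_def C_def using g1 g2 g3 uv by (auto simp: path_image_join)
  then have JD: "J \<subseteq> drawing (p ` V) E \<gamma>" using e w wu by (auto simp: drawing_def)
  have fr: "frontier (inside J) = J" "frontier (outside J) = J"
    using Jordan_inside_outside[OF simp] by (simp_all add: J_def)
  have xJ: "\<gamma> e (1/2) \<in> J" using im J by blast
  have gJ: "path_image (\<gamma> e) \<subseteq> J" using J by blast
  have "\<gamma> e (1/2) \<in> closure (inside J)" "\<gamma> e (1/2) \<in> closure (outside J)"
    using xJ fr by (metis DiffD1 frontier_def)+
  moreover have "inside J \<inter> path_image (\<gamma> e) = {}" "outside J \<inter> path_image (\<gamma> e) = {}"
    using gJ inside_no_overlap[of J] outside_no_overlap[of J] by blast+
  ultimately obtain F F' where F: "F \<in> faces (p ` V) E \<gamma>" "F \<inter> inside J \<noteq> {}" "e \<in> boundary_edges E \<gamma> F"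
    and F': "F' \<in> faces (p ` V) E \<gamma>" "F' \<inter> outside J \<noteq> {}" "e \<in> boundary_edges E \<gamma> F'"
    using face_near_inner_point[OF pg e half] by metis
  \<comment> \<open>\<open>J\<close> is part of the drawing, so the connected set \<open>F\<close>
    cannot cross it.\<close>
  have "F \<subseteq> inside J"
  proof (rule ccontr)
    assume "\<not> F \<subseteq> inside J"
    then have "F \<inter> frontier (inside J) \<noteq> {}"
      using connected_Int_frontier[of F "inside J"] F(2) face_properties(2)[OF pg F(1)] by blast
    then show False using fr JD face_properties(4)[OF pg F(1)] by blast
  qed
  then have "F \<noteq> F'" using F'(2) inside_Int_outside[of J] by blast
  then show ?thesis using that F F' by blast
qed

section \<open>Vertices of degree two in the conjugated triangulation\<close>

text \<open>If every face at \<open>e\<close> were bounded, each of the two faces would contribute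
  at least two edges of the conjugated triangulation at the midpoint.\<close>

lemma degree_2_boundary_unbounded_face:
  assumes H: "planar_conjugated_triangulation V E p \<gamma> \<delta>"
    and e: "e \<in> E" and deg: "vertex_degree (conj_edges V E p \<gamma>) \<delta> (edge_midpoint \<gamma> e) = 2"
  obtains F where "F \<in> faces (p ` V) E \<gamma>" "\<not> bounded F" "e \<in> boundary_edges E \<gamma> F"
proof (rule ccontr)
  assume "\<not> thesis"
  then have bdd: "\<And>F. F \<in> faces (p ` V) E \<gamma> \<Longrightarrow> e \<in> boundary_edges E \<gamma> F \<Longrightarrow> bounded F"
    using that by blast
  let ?x = "edge_midpoint \<gamma> e"
  let ?S = "{c \<in> conj_edges V E p \<gamma>. ?x = pathstart (\<delta> c) \<or> ?x = pathfinish (\<delta> c)}"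
  have fin: "finite ?S" using H by (auto simp: planar_conjugated_triangulation_def plane_graph_def)
  have inS: "(F, {e, d}) \<in> ?S"
    if "F \<in> faces (p ` V) E \<gamma>" "e \<in> boundary_edges E \<gamma> F" "d \<in> boundary_edges E \<gamma> F" "d \<noteq> e" for F d
  proof -
    have c: "(F, {e, d}) \<in> conj_edges V E p \<gamma>"
      using that bdd unfolding conj_edges_def by blast
    then have "{pathstart (\<delta> (F, {e, d})), pathfinish (\<delta> (F, {e, d}))} = {?x, edge_midpoint \<gamma> d}"
      using H unfolding planar_conjugated_triangulation_def by blast
    then show ?thesis using c by blast
  qed
  have other: "\<exists>d d'. d \<in> boundary_edges E \<gamma> F - {e} \<and> d' \<in> boundary_edges E \<gamma> F - {e} \<and> d \<noteq> d'"
    if "F \<in> faces (p ` V) E \<gamma>" "e \<in> boundary_edges E \<gamma> F" for F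
  proof -
    have "card (boundary_edges E \<gamma> F - {e}) \<ge> 2"
      using card_boundary_edges[OF that] that(2) by (simp add: card_Diff_singleton)
    then obtain T where "T \<subseteq> boundary_edges E \<gamma> F - {e}" "card T = 2" by (meson obtain_subset_with_card_n)
    then show ?thesis by (auto simp: card_2_iff)
  qed
  obtain F F' where F: "F \<in> faces (p ` V) E \<gamma>" "F' \<in> faces (p ` V) E \<gamma>" "F \<noteq> F'"
    "e \<in> boundary_edges E \<gamma> F" "e \<in> boundary_edges E \<gamma> F'"
    using two_faces_at_edge[OF e] by metis
  obtain d d' where d: "d \<in> boundary_edges E \<gamma> F" "d' \<in> boundary_edges E \<gamma> F" "d \<noteq> e" "d' \<noteq> e" "d \<noteq> d'"
    using other[OF F(1,4)] by blast
  obtain b where b: "b \<in> boundary_edges E \<gamma> F'" "b \<noteq> e" using other[OF F(2,5)] by blast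
  \<comment> \<open>Three edges suffice against degree two. The last differs from the others by its
    face, even if \<open>b\<close> is \<open>d\<close> or \<open>d'\<close>.\<close>
  have "{(F, {e, d}), (F, {e, d'}), (F', {e, b})} \<subseteq> ?S"
    using inS[OF F(1,4) d(1,3)] inS[OF F(1,4) d(2,4)] inS[OF F(2,5) b] by blast
  then have "card {(F, {e, d}), (F, {e, d'}), (F', {e, b})} \<le> card ?S" by (rule card_mono[OF fin])
  moreover have "card {(F, {e, d}), (F, {e, d'}), (F', {e, b})} = 3"
    using d F(3) by (simp add: doubleton_eq_iff)
  ultimately show False using deg by (simp add: vertex_degree_def)
qed

end

theorem theorem13:
  fixes V :: "'a set" and E :: "'a set set"
    and p :: "'a \<Rightarrow> complex" and \<gamma> :: "'a set \<Rightarrow> real \<Rightarrow> complex"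
    and \<delta> :: "complex set \<times> 'a set set \<Rightarrow> real \<Rightarrow> complex" and x :: complex
  assumes "planar_triangulation V E"
    and "card V \<ge> 3"
    and "plane_embedding V E p \<gamma>"
    and "planar_conjugated_triangulation V E p \<gamma> \<delta>"
    and "x \<in> conj_vertices E \<gamma>"
    and "vertex_degree (conj_edges V E p \<gamma>) \<delta> x = 2"
  shows "external_vertex (conj_vertices E \<gamma>) (conj_edges V E p \<gamma>) \<delta> x"
proof -
  let ?D = "drawing (conj_vertices E \<gamma>) (conj_edges V E p \<gamma>) \<delta>"
  have pg: "plane_graph (p ` V) E \<gamma>" using assms(3) by (simp add: plane_embedding_def)
  obtain e where e: "e \<in> E" "x = edge_midpoint \<gamma> e" using assms(5) by (auto simp: conj_vertices_def)
  then obtain F where F: "F \<in> faces (p ` V) E \<gamma>" "\<not> bounded F" "e \<in> boundary_edges E \<gamma> F"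
    using degree_2_boundary_unbounded_face[OF assms(1-4) e(1)] assms(6) by metis
  have mid: "edge_midpoint \<gamma> d \<in> path_image (\<gamma> d)" for d
    by (auto simp: edge_midpoint_def path_image_def)
  have xF: "x \<in> closure F"
    using F(3) e mid[of e] unfolding boundary_edges_def frontier_def by blast
  \<comment> \<open>Apart from their ends, the new edges run inside bounded faces. Hence the
    unbounded face \<open>F\<close> misses the new drawing and lies in one of its faces.\<close>
  have conj_path: "path_image (\<delta> c) \<subseteq> conj_vertices E \<gamma> \<union> F'"
    if c: "c \<in> conj_edges V E p \<gamma>" "F' = fst c" for c F'
  proof -
    obtain d d' where d: "c = (F', {d, d'})" "d \<in> E" "d' \<in> E"
      using c unfolding conj_edges_def boundary_edges_def by fastforce
    then have "path_image (\<delta> c) - {edge_midpoint \<gamma> d, edge_midpoint \<gamma> d'} \<subseteq> F'"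
      using assms(4) c(1) unfolding planar_conjugated_triangulation_def by blast
    then show ?thesis using d by (auto simp: conj_vertices_def)
  qed
  have "F \<inter> conj_vertices E \<gamma> = {}"
    using face_properties(4)[OF pg F(1)] mid path_image_subset_drawing[OF pg] unfolding conj_vertices_def by blast
  moreover have "F \<inter> F' = {}" if "c \<in> conj_edges V E p \<gamma>" "F' = fst c" for c F'
  proof -
    have "F' \<in> faces (p ` V) E \<gamma>" "bounded F'" using that by (auto simp: conj_edges_def)
    then show ?thesis using faces_eq[OF pg F(1)] F(2) by blast
  qed
  ultimately have FD: "F \<subseteq> - ?D"
    using conj_path unfolding drawing_def by blast
  obtain y where y: "y \<in> F" using face_properties(3)[OF pg F(1)] by blast
  \<comment> \<open>\<open>G\<close> is the face of the new drawing that contains \<open>F\<close>: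
    it is unbounded because \<open>F\<close> is, and \<open>x\<close> lies in its closure because
    \<open>x\<close> lies in that of \<open>F\<close>.\<close>
  define G where "G = connected_component_set (- ?D) y"
  have "G \<in> faces (conj_vertices E \<gamma>) (conj_edges V E p \<gamma>) \<delta>"
    unfolding faces_def G_def using FD y by (intro componentsI) blast
  moreover have FG: "F \<subseteq> G"
    unfolding G_def using connected_component_maximal y FD face_properties(2)[OF pg F(1)] by blast
  moreover have "\<not> bounded G" using F(2) FG bounded_subset by blast
  moreover have "x \<in> frontier G"
  proof -
    have "x \<in> ?D" using assms(5) by (simp add: drawing_def)
    then have "x \<notin> G" unfolding G_def using connected_component_subset by blast
    then show ?thesis using xF closure_mono[OF FG] interior_subset unfolding frontier_def by blast
  qed
  ultimately show ?thesis using assms(5) unfolding external_vertex_def by blast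
qed

end
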